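(* Let $\mathcal{D}$ be a totally ordered set; the set of biletters $\binom{0}{d}$, $d\in\mathcal{D}$, is totally ordered accordingly. 1. The pre-Lie algebra $T(V_{\mathcal{D}},f_{\mathcal{D}})$ is generated by the set of words (including the empty word) in the biletters $\binom{0}{d}$, $d\in\mathcal{D}$. Moreover, this set is a minimal set of generators. 2. The Com-Pre-Lie algebra $T(V_{\mathcal{D}},f_{\mathcal{D}})$ is generated by $\emptyset$ and the set of Lyndon words in the biletters $\binom{0}{d}$, $d\in\mathcal{D}$. Moreover, this set is a minimal set of generators.
   Context: $\mathbb{K}$ is a field of characteristic zero. For a vector space $V$, $T(V)=\bigoplus_{n\ge 0}V^{\otimes n}$ is spanned by words with letters in $V$; $\emptyset$ is the empty word; juxtaposition is concatenation. The shuffle product $\sqcup\!\sqcup$ is the bilinear product with unit $\emptyset$ and $xu\sqcup\!\sqcup yv=x(u\sqcup\!\sqcup yv)+y(xu\sqcup\!\sqcup v)$ for $x,y\in V$, $u,v\in T(V)$. For a linear endomorphism $f$ of $V$, the bilinear product $\bullet$ on $T(V)$ is defined by $\emptyset\bullet w'=0$ and $(xw)\bullet w'=x(w\bullet w')+f(x)(w\sqcup\!\sqcup w')$ for $x\in V$, $w,w'\in T(V)$. $T(V,f)$ denotes $T(V)$ with these two products. It is a Com-Pre-Lie algebra: $\sqcup\!\sqcup$ is commutative and associative, $\bullet$ is right pre-Lie, i.e. $(a\bullet b)\bullet c-a\bullet(b\bullet c)=(a\bullet c)\bullet b-a\bullet(c\bullet b)$, and $(a\sqcup\!\sqcup b)\bullet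 c=(a\bullet c)\sqcup\!\sqcup b+a\sqcup\!\sqcup(b\bullet c)$. "Generated as a pre-Lie algebra" means using $\bullet$ (and linear combinations); "generated as a Com-Pre-Lie algebra" means using $\sqcup\!\sqcup$ and $\bullet$. $V_{\mathcal{D}}$ is the vector space with basis the biletters $\binom{k}{d}$, $(k,d)\in\mathbb{N}\times\mathcal{D}$ (with $0\in\mathbb{N}$), and $f_{\mathcal{D}}:V_{\mathcal{D}}\to V_{\mathcal{D}}$ is the linear map with $f_{\mathcal{D}}\binom{k}{d}=\binom{k+1}{d}$. *)

theory Defs
  imports Complex_Main "HOL-Library.Poly_Mapping"
begin

section \<open>Vector spaces with a given basis\<close>

text \<open>The finitely supported functions \<open>'b \<Rightarrow>\<^sub>0 'k\<close> form the \<open>'k\<close>-vector space with basis \<open>'b\<close>; the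
  basis vector of \<open>b\<close> is \<open>basis b\<close>.\<close>

definition scale :: "'k::field \<Rightarrow> ('b \<Rightarrow>\<^sub>0 'k) \<Rightarrow> ('b \<Rightarrow>\<^sub>0 'k)" where
  "scale c p = Poly_Mapping.map ((*) c) p"

definition basis :: "'b \<Rightarrow> ('b \<Rightarrow>\<^sub>0 'k::field)" where
  "basis b = Poly_Mapping.single b 1"

lemma lookup_scale [simp]: "Poly_Mapping.lookup (scale c p) b = c * Poly_Mapping.lookup p b"
  unfolding scale_def by transfer (simp add: when_def)

interpretation free: vector_space "scale :: 'k::field \<Rightarrow> ('b \<Rightarrow>\<^sub>0 'k) \<Rightarrow> ('b \<Rightarrow>\<^sub>0 'k)"
  by standard (auto intro!: poly_mapping_eqI simp: lookup_add algebra_simps)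

definition supported_on :: "'b set \<Rightarrow> ('b \<Rightarrow>\<^sub>0 'k::field) set" where
  "supported_on B = {p. Poly_Mapping.keys p \<subseteq> B}"

definition lin_ext :: "('b \<Rightarrow> ('c \<Rightarrow>\<^sub>0 'k::field)) \<Rightarrow> ('b \<Rightarrow>\<^sub>0 'k) \<Rightarrow> ('c \<Rightarrow>\<^sub>0 'k)" where
  "lin_ext g p = (\<Sum>b\<in>Poly_Mapping.keys p. scale (Poly_Mapping.lookup p b) (g b))"

definition bilin_ext ::
  "('a \<Rightarrow> 'b \<Rightarrow> ('c \<Rightarrow>\<^sub>0 'k::field)) \<Rightarrow> ('a \<Rightarrow>\<^sub>0 'k) \<Rightarrow> ('b \<Rightarrow>\<^sub>0 'k) \<Rightarrow> ('c \<Rightarrow>\<^sub>0 'k)" where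
  "bilin_ext g p q = lin_ext (\<lambda>a. lin_ext (g a) q) p"

lemma lin_ext_superset:
  assumes "finite A" "Poly_Mapping.keys p \<subseteq> A"
  shows "lin_ext g p = (\<Sum>b\<in>A. scale (Poly_Mapping.lookup p b) (g b))"
  unfolding lin_ext_def using assms
  by (intro sum.mono_neutral_left) (auto simp: in_keys_iff)

lemma lin_ext_basis [simp]: "lin_ext g (basis b) = g b"
  by (simp add: lin_ext_def basis_def)

lemma lin_ext_zero [simp]: "lin_ext g 0 = 0"
  by (simp add: lin_ext_def)

lemma lin_ext_add: "lin_ext g (p + q) = lin_ext g p + lin_ext g q"
proof -
  let ?A = "Poly_Mapping.keys p \<union> Poly_Mapping.keys q"
  have *: "Poly_Mapping.keys (p + q) \<subseteq> ?A" by (rule keys_add)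
  show ?thesis
    by (simp add: lin_ext_superset[of ?A] * lookup_add free.scale_left_distrib sum.distrib)
qed

lemma lin_ext_scale: "lin_ext g (scale c p) = scale c (lin_ext g p)"
proof -
  have *: "Poly_Mapping.keys (scale c p) \<subseteq> Poly_Mapping.keys p" by (auto simp: in_keys_iff)
  show ?thesis
    unfolding lin_ext_superset[OF finite_keys *] by (simp add: lin_ext_def free.scale_sum_right)
qed

lemma linear_lin_ext: "Vector_Spaces.linear scale scale (lin_ext g)"
  by (intro Vector_Spaces.linear.intro module_hom.intro module_hom_axioms.intro)
     (unfold_locales, auto simp: lin_ext_add lin_ext_scale)

section \<open>The Com-Pre-Lie algebra of words\<close>

text \<open>For \<open>V\<close> with basis \<open>'x\<close>, words in the letters \<open>'x\<close> form a basis of the tensor algebra of \<open>V\<close>.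
  The map \<open>cons_vec\<close> is the concatenation of a vector of \<open>V\<close> with a tensor.\<close>

type_synonym ('x, 'k) tensor = "'x list \<Rightarrow>\<^sub>0 'k"

definition tensor_space :: "'x set \<Rightarrow> ('x, 'k::field) tensor set" where
  "tensor_space X = supported_on (lists X)"

definition cons_vec :: "('x \<Rightarrow>\<^sub>0 'k::field) \<Rightarrow> ('x, 'k) tensor \<Rightarrow> ('x, 'k) tensor" where
  "cons_vec = bilin_ext (\<lambda>x w. basis (x # w))"

fun shuffle_words :: "'x list \<Rightarrow> 'x list \<Rightarrow> ('x, 'k::field) tensor" where
  "shuffle_words [] v = basis v"
| "shuffle_words (x # u) [] = basis (x # u)"
| "shuffle_words (x # u) (y # v) =
     cons_vec (basis x) (shuffle_words u (y # v)) + cons_vec (basis y) (shuffle_words (x # u) v)"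

definition shuffle :: "('x, 'k::field) tensor \<Rightarrow> ('x, 'k) tensor \<Rightarrow> ('x, 'k) tensor" where
  "shuffle = bilin_ext shuffle_words"

fun bullet_words ::
  "(('x \<Rightarrow>\<^sub>0 'k::field) \<Rightarrow> ('x \<Rightarrow>\<^sub>0 'k)) \<Rightarrow> 'x list \<Rightarrow> 'x list \<Rightarrow> ('x, 'k) tensor" where
  "bullet_words f [] v = 0"
| "bullet_words f (x # w) v =
     cons_vec (basis x) (bullet_words f w v) + cons_vec (f (basis x)) (shuffle_words w v)"

definition bullet ::
  "(('x \<Rightarrow>\<^sub>0 'k::field) \<Rightarrow> ('x \<Rightarrow>\<^sub>0 'k)) \<Rightarrow> ('x, 'k) tensor \<Rightarrow> ('x, 'k) tensor \<Rightarrow> ('x, 'k) tensor" where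
  "bullet f = bilin_ext (bullet_words f)"

text \<open>The recursions above are stated on basis letters and words only; by (bi)linearity they hold for
  arbitrary vectors and tensors.\<close>

lemma bilin_ext_basis [simp]: "bilin_ext g (basis a) (basis b) = g a b"
  by (simp add: bilin_ext_def)

lemma bilin_ext_add_left: "bilin_ext g (p + p') q = bilin_ext g p q + bilin_ext g p' q"
  by (simp add: bilin_ext_def lin_ext_add)

lemma bilin_ext_scale_left: "bilin_ext g (scale c p) q = scale c (bilin_ext g p q)"
  by (simp add: bilin_ext_def lin_ext_scale)

lemma bilin_ext_add_right: "bilin_ext g p (q + q') = bilin_ext g p q + bilin_ext g p q'"
  unfolding bilin_ext_def
  by (simp add: lin_ext_add) (simp add: lin_ext_def free.scale_right_distrib sum.distrib)

lemma bilin_ext_scale_right: "bilin_ext g p (scale c q) = scale c (bilin_ext g p q)"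
  unfolding bilin_ext_def
  by (simp add: lin_ext_scale) (simp add: lin_ext_def free.scale_sum_right mult.left_commute)

lemma bilin_ext_zero [simp]: "bilin_ext g 0 q = 0" "bilin_ext g p 0 = 0"
  by (simp_all add: bilin_ext_def lin_ext_def)

lemma free_induct [case_names zero step]:
  assumes "P 0" and "\<And>c b p. P p \<Longrightarrow> P (scale c (basis b) + p)"
  shows "P p"
proof -
  have "P (\<Sum>b\<in>A. scale (Poly_Mapping.lookup p b) (basis b))" if "finite A" for A
    using that by (induction rule: finite_induct) (simp_all add: assms)
  moreover have "(\<Sum>b\<in>Poly_Mapping.keys p. scale (Poly_Mapping.lookup p b) (basis b)) = p"
    by (rule poly_mapping_eqI)
       (simp add: lookup_sum basis_def lookup_single when_def if_distrib sum.delta in_keys_iff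
          cong: if_cong)
  ultimately show ?thesis using finite_keys by metis
qed

lemmas bilin_ext_simps =
  bilin_ext_add_left bilin_ext_scale_left bilin_ext_add_right bilin_ext_scale_right bilin_ext_zero

lemmas bilin_simps = free.scale_right_distrib
  bilin_ext_simps[of shuffle_words, folded shuffle_def]
  bilin_ext_simps[of "\<lambda>x w. basis (x # w)", folded cons_vec_def]
  bilin_ext_simps[of "bullet_words f" for f, folded bullet_def]

lemma product_basis:
  "cons_vec (basis x) (basis w) = basis (x # w)"
  "shuffle (basis u) (basis v) = shuffle_words u v"
  "bullet f (basis u) (basis v) = bullet_words f u v"
  by (simp_all add: cons_vec_def shuffle_def bullet_def)

lemma shuffle_Nil: "shuffle (basis []) p = p" "shuffle p (basis []) = p"
proof -
  have [simp]: "shuffle_words u [] = (basis u :: ('x, 'k::field) tensor)" for u :: "'x list"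
    by (cases u) simp_all
  show "shuffle (basis []) p = p"
    by (induction p rule: free_induct) (simp_all add: product_basis bilin_simps)
  show "shuffle p (basis []) = p"
    by (induction p rule: free_induct) (simp_all add: product_basis bilin_simps)
qed

lemma shuffle_cons_vec:
  "shuffle (cons_vec x u) (cons_vec y v) =
     cons_vec x (shuffle u (cons_vec y v)) + cons_vec y (shuffle (cons_vec x u) v)"
proof -
  have 4: "shuffle (cons_vec (basis a) (basis b)) (cons_vec (basis c) (basis d)) =
      cons_vec (basis a) (shuffle (basis b) (cons_vec (basis c) (basis d))) + cons_vec (basis c) (shuffle (cons_vec (basis a) (basis b)) (basis d))"
    for a b c d by (simp add: product_basis)
  have 3: "shuffle (cons_vec (basis a) (basis b)) (cons_vec (basis c) v) =
      cons_vec (basis a) (shuffle (basis b) (cons_vec (basis c) v)) + cons_vec (basis c) (shuffle (cons_vec (basis a) (basis b)) v)"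
    for a b c v
    by (induction v rule: free_induct) (simp_all add: 4 bilin_simps algebra_simps)
  have 2: "shuffle (cons_vec (basis a) (basis b)) (cons_vec y v) =
      cons_vec (basis a) (shuffle (basis b) (cons_vec y v)) + cons_vec y (shuffle (cons_vec (basis a) (basis b)) v)"
    for a b y v
    by (induction y rule: free_induct) (simp_all add: 3 bilin_simps algebra_simps)
  have 1: "shuffle (cons_vec (basis a) u) (cons_vec y v) =
      cons_vec (basis a) (shuffle u (cons_vec y v)) + cons_vec y (shuffle (cons_vec (basis a) u) v)"
    for a u y v
    by (induction u rule: free_induct) (simp_all add: 2 bilin_simps algebra_simps)
  show ?thesis
    by (induction x rule: free_induct) (simp_all add: 1 bilin_simps algebra_simps)
qed

lemma bullet_Nil: "bullet f (basis []) p = 0"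
  by (induction p rule: free_induct) (simp_all add: product_basis bilin_simps)

lemma bullet_cons_vec:
  assumes "Vector_Spaces.linear scale scale f"
  shows "bullet f (cons_vec x w) w' = cons_vec x (bullet f w w') + cons_vec (f x) (shuffle w w')"
proof -
  interpret f: Vector_Spaces.linear scale scale f by fact
  note [simp] = f.zero f.add f.scale
  have 3: "bullet f (cons_vec (basis a) (basis b)) (basis c) =
      cons_vec (basis a) (bullet f (basis b) (basis c)) + cons_vec (f (basis a)) (shuffle (basis b) (basis c))"
    for a b c by (simp add: product_basis)
  have 2: "bullet f (cons_vec (basis a) (basis b)) w' =
      cons_vec (basis a) (bullet f (basis b) w') + cons_vec (f (basis a)) (shuffle (basis b) w')"
    for a b w'
    by (induction w' rule: free_induct) (simp_all add: 3 bilin_simps algebra_simps)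
  have 1: "bullet f (cons_vec (basis a) w) w' =
      cons_vec (basis a) (bullet f w w') + cons_vec (f (basis a)) (shuffle w w')"
    for a w w'
    by (induction w rule: free_induct) (simp_all add: 2 bilin_simps algebra_simps)
  show ?thesis
    by (induction x rule: free_induct) (simp_all add: 1 bilin_simps algebra_simps)
qed

text \<open>The subalgebras generated by a set, for \<open>\<bullet>\<close> alone and for both products. The unit \<open>\<emptyset>\<close> of the
  shuffle product is not adjoined automatically.\<close>

definition pre_lie_generated ::
  "(('x \<Rightarrow>\<^sub>0 'k::field) \<Rightarrow> ('x \<Rightarrow>\<^sub>0 'k)) \<Rightarrow> ('x, 'k) tensor set \<Rightarrow> ('x, 'k) tensor set" where
  "pre_lie_generated f G =
     (\<lambda>S. free.subspace S \<and> (\<forall>a\<in>S. \<forall>b\<in>S. bullet f a b \<in> S)) hull G"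

definition com_pre_lie_generated ::
  "(('x \<Rightarrow>\<^sub>0 'k::field) \<Rightarrow> ('x \<Rightarrow>\<^sub>0 'k)) \<Rightarrow> ('x, 'k) tensor set \<Rightarrow> ('x, 'k) tensor set" where
  "com_pre_lie_generated f G =
     (\<lambda>S. free.subspace S \<and> (\<forall>a\<in>S. \<forall>b\<in>S. shuffle a b \<in> S \<and> bullet f a b \<in> S)) hull G"

section \<open>Biletters and Lyndon words\<close>

text \<open>The pair \<open>(k, d)\<close> encodes the biletter with upper entry \<open>k\<close> and lower entry \<open>d\<close>.\<close>

definition biletters :: "'d set \<Rightarrow> (nat \<times> 'd) set" where
  "biletters D = UNIV \<times> D"

definition biletters0 :: "'d set \<Rightarrow> (nat \<times> 'd) set" where
  "biletters0 D = {0} \<times> D"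

definition biletters0_less :: "((nat \<times> 'd::linorder) \<times> (nat \<times> 'd)) set" where
  "biletters0_less = {((0, d), (0, e)) | d e. d < e}"

definition raise :: "(nat \<times> 'd \<Rightarrow>\<^sub>0 'k::field) \<Rightarrow> (nat \<times> 'd \<Rightarrow>\<^sub>0 'k)" where
  "raise = lin_ext (\<lambda>(k, d). basis (Suc k, d))"

text \<open>A nonempty word is Lyndon if it is smaller than each of its proper nonempty suffixes, in the
  lexicographic order in which a proper prefix of a word precedes that word.\<close>

definition lyndon :: "('x \<times> 'x) set \<Rightarrow> 'x list \<Rightarrow> bool" where
  "lyndon r w \<longleftrightarrow>
     w \<noteq> [] \<and> (\<forall>u v. w = u @ v \<longrightarrow> u \<noteq> [] \<longrightarrow> v \<noteq> [] \<longrightarrow> (w, v) \<in> lexord r)"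

definition words0 :: "'d set \<Rightarrow> (nat \<times> 'd, 'k::field) tensor set" where
  "words0 D = basis ` lists (biletters0 D)"

definition lyndon_words0 :: "'d::linorder set \<Rightarrow> (nat \<times> 'd, 'k::field) tensor set" where
  "lyndon_words0 D = basis ` {w \<in> lists (biletters0 D). lyndon biletters0_less w}"

end

theory Submission
  imports Defs "HOL-Library.Multiset" "HOL-Library.List_Lexorder" "HOL-Library.Product_Lexorder"
begin

text \<open>
  The whole argument is governed by the weight of a word, the sum of the upper entries of its
  biletters. The shuffle product preserves the total weight and \<open>\<bullet>\<close> raises it by exactly one, so the
  products \<open>a \<bullet> b\<close> live in positive weight, whereas the proposed generators all have weight zero.

  \<^emph>\<open>Pre-Lie generation.\<close> Every word of weight \<open>m + 1\<close> is a linear combination of products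
  \<open>u \<bullet> v\<close> of words of total weight \<open>m\<close> (\<open>positive_weight_in_span_bullets\<close>). If its first letter is
  \<open>f(y)\<close>, then the word is \<open>f(y) w = y \<bullet> w\<close>. If its first letter \<open>x\<close> has weight zero, the tail can
  by induction be taken to be \<open>u \<bullet> v\<close>, and \<open>x (u \<bullet> v) = xu \<bullet> v - f(x) (u \<squnion> v)\<close>, where \<open>\<squnion>\<close> stands for
  the shuffle product and the last term begins with a raised letter. Induction on the weight thus
  reaches all words from those of weight zero. A generator \<open>w\<close> cannot be omitted, because the
  coefficient of \<open>w\<close> vanishes on all products \<open>a \<bullet> b\<close>.

  \<^emph>\<open>Com-Pre-Lie generation.\<close> Modulo positive weight only the shuffle product survives, and the claim
  becomes Radford's theorem that the shuffle monomials in Lyndon words form a basis. It follows from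
  a triangularity: if \<open>l\<^sub>1 \<ge> \<dots> \<ge> l\<^sub>n\<close> are Lyndon words, then their concatenation is the
  lexicographically largest word in the support of their shuffle product
  (\<open>multi_shuffles_le_concat\<close>); its coefficient is a positive integer, so it is invertible in
  characteristic zero. As every word has exactly one nonincreasing factorization into Lyndon words,
  distinct monomials have distinct leading words. Spanning gives generation
  (\<open>basis_mem_shuffle_closed\<close>), and linear independence shows that no Lyndon word is a combination of
  monomials in the other ones (\<open>Lyndon_word_not_in_span\<close>). The empty word cannot be obtained from
  nonempty ones since neither product of an element without constant term has a constant term.

  The maximality of the concatenation is an exchange argument. When several words are merged into a
  lexicographically large one, it pays to take the next letter from the largest of the remaining
  words (\<open>shuffles_move_to_smaller\<close>). The suffixes of a Lyndon word \<open>l\<^sub>1\<close> only become larger, so once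
  \<open>l\<^sub>1\<close> has been started it should be used up before the smaller factors are touched.
\<close>

section \<open>Shuffles and the lexicographic order\<close>

lemma le_append [simp]: "xs \<le> xs @ (ys :: 'a::linorder list)"
  by (induction xs) simp_all

lemma append_le_append_iff [simp]: "xs @ ys \<le> xs @ zs \<longleftrightarrow> ys \<le> (zs :: 'a::linorder list)"
  by (induction xs) simp_all

lemma append_less_append_iff [simp]: "xs @ ys < xs @ zs \<longleftrightarrow> ys < (zs :: 'a::linorder list)"
  by (induction xs) simp_all

text \<open>The comparison is decided at a letter where the two words differ, so continuations are
  irrelevant.\<close>

lemma append_less_append_if_not_prefix:
  "u < s \<Longrightarrow> \<nexists>t. s = u @ t \<Longrightarrow> u @ v < s @ (t :: 'a::linorder list)"
proof (induction u arbitrary: s)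
  case (Cons a u)
  then show ?case by (cases s) auto
qed simp

lemma append_in_shuffles: "u @ v \<in> shuffles u v"
proof (induction u)
  case (Cons a u)
  then show ?case by (simp add: Cons_in_shuffles_leftI)
qed simp

lemma shuffles_left_commute:
  "s \<in> shuffles a v \<Longrightarrow> v \<in> shuffles b c \<Longrightarrow> \<exists>v'\<in>shuffles a c. s \<in> shuffles b v'"
proof (induction s arbitrary: a b c v)
  case (Cons x s)
  from Cons.prems(1) consider
      a' where "a = x # a'" "s \<in> shuffles a' v"
    | v' where "v = x # v'" "s \<in> shuffles a v'"
    by (cases a; cases v) (auto simp: Cons_in_shuffles_iff)
  then show ?case
  proof cases
    case 1
    with Cons.IH[OF 1(2) Cons.prems(2)] show ?thesis
      by (meson Cons_in_shuffles_leftI Cons_in_shuffles_rightI)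
  next
    case 2
    from Cons.prems(2) 2(1) consider
        b' where "b = x # b'" "v' \<in> shuffles b' c"
      | c' where "c = x # c'" "v' \<in> shuffles b c'"
      by (cases b; cases c) (auto simp: Cons_in_shuffles_iff)
    then show ?thesis
      using Cons.IH[OF 2(2)] by cases (meson Cons_in_shuffles_leftI Cons_in_shuffles_rightI)+
  qed
qed auto

lemma shuffles_mono_right:
  assumes "u \<le> v" "s \<in> shuffles x u"
  shows "\<exists>t\<in>shuffles x v. s \<le> (t :: 'a::linorder list)"
  using assms
proof (induction s arbitrary: x u v)
  case Nil
  then show ?case using append_in_shuffles[of x v] by auto
next
  case (Cons c s)
  from Cons.prems(2) consider
      x' where "x = c # x'" "s \<in> shuffles x' u"
    | u' where "u = c # u'" "s \<in> shuffles x u'"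
    by (cases x; cases u) (auto simp: Cons_in_shuffles_iff)
  then show ?case
  proof cases
    case 1
    from Cons.IH[OF Cons.prems(1) 1(2)] obtain t where "t \<in> shuffles x' v" "s \<le> t" by blast
    with 1 show ?thesis by (intro bexI[of _ "c # t"]) (auto intro: Cons_in_shuffles_leftI)
  next
    case 2
    with Cons.prems(1) obtain d v' where v: "v = d # v'" and cd: "c < d \<or> c = d \<and> u' \<le> v'"
      by (cases v) auto
    show ?thesis
    proof (cases "c < d")
      case True
      have "d # (x @ v') \<in> shuffles x v"
        unfolding v by (intro Cons_in_shuffles_rightI append_in_shuffles)
      with True show ?thesis by (intro bexI[of _ "d # (x @ v')"]) auto
    next
      case False
      with cd Cons.IH[OF _ 2(2)] obtain t where "t \<in> shuffles x v'" "s \<le> t" by blast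
      with v cd False show ?thesis by (intro bexI[of _ "c # t"]) (auto intro: Cons_in_shuffles_rightI)
    qed
  qed
qed

text \<open>The exchange step. A block \<open>z\<close> in front of the larger word \<open>x\<close> may be moved in front of the
  smaller word \<open>y\<close> without making the best merge smaller: whenever the merge takes a letter from \<open>y\<close>,
  the first letter of \<open>x\<close> is at least as good. The block has to be arbitrary for the induction, because
  it absorbs the letters that \<open>x\<close> and \<open>y\<close> have in common.\<close>

lemma shuffles_move_to_smaller:
  assumes "y \<le> x" "s \<in> shuffles (z @ x) y"
  shows "\<exists>t\<in>shuffles x (z @ y). s \<le> (t :: 'a::linorder list)"
  using assms
proof (induction s arbitrary: x y z)
  case Nil
  then show ?case by auto
next
  case (Cons c s)
  show ?case
  proof (cases z)
    case Nil
    with Cons.prems(2) show ?thesis by auto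
  next
    case (Cons a z')
    from Cons.prems(2) Cons consider
        "a = c" "s \<in> shuffles (z' @ x) y"
      | y' where "y = c # y'" "s \<in> shuffles (z @ x) y'"
      by (cases y) (auto simp: Cons_in_shuffles_iff)
    then show ?thesis
    proof cases
      case 1
      from Cons.IH[OF Cons.prems(1) 1(2)] obtain t where "t \<in> shuffles x (z' @ y)" "s \<le> t"
        by blast
      with 1 Cons show ?thesis
        by (intro bexI[of _ "c # t"]) (auto intro: Cons_in_shuffles_rightI)
    next
      case 2
      with Cons.prems(1) obtain d x' where x: "x = d # x'" and cd: "c < d \<or> c = d \<and> y' \<le> x'"
        by (cases x) auto
      show ?thesis
      proof (cases "c < d")
        case True
        have "d # (x' @ z @ y) \<in> shuffles x (z @ y)"
          unfolding x by (intro Cons_in_shuffles_leftI append_in_shuffles)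
        with True show ?thesis by (intro bexI[of _ "d # (x' @ z @ y)"]) auto
      next
        case False
        with cd have c: "d = c" "y' \<le> x'" by auto
        \<comment> \<open>The common first letter of both words joins the block that is moved.\<close>
        have "s \<in> shuffles ((z @ [c]) @ x') y'" using 2(2) x c by simp
        from Cons.IH[OF c(2) this] obtain t where "t \<in> shuffles x' (z @ y)" "s \<le> t"
          using 2(1) by auto
        with x c show ?thesis
          by (intro bexI[of _ "c # t"]) (auto intro: Cons_in_shuffles_leftI)
      qed
    qed
  qed
qed

text \<open>Each remaining suffix \<open>q\<close> of \<open>r\<close> is at least \<open>y\<close>, so taking the next letter from \<open>r\<close> is always
  a best choice. If a merge starts with \<open>y\<close> instead and the first letters agree, the exchange step with
  this letter as the block turns it into one that starts with \<open>r\<close>.\<close>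

lemma shuffles_le_prefix_first:
  assumes "\<And>p q. r = p @ q \<Longrightarrow> q \<noteq> [] \<Longrightarrow> y \<le> q" "s \<in> shuffles y (r @ t)"
  shows "\<exists>t'\<in>shuffles y t. s \<le> r @ (t' :: 'a::linorder list)"
  using assms
proof (induction r arbitrary: s)
  case Nil
  then show ?case by auto
next
  case (Cons a r)
  have IH: "\<exists>t'\<in>shuffles y t. s' \<le> r @ t'" if "s' \<in> shuffles y (r @ t)" for s'
    using that Cons.prems(1) by (intro Cons.IH) (auto simp: Cons_eq_append_conv)
  have y_le: "y \<le> a # r" using Cons.prems(1)[of "[]" "a # r"] by simp
  from Cons.prems(2) consider
      s' where "s = a # s'" "s' \<in> shuffles y (r @ t)"
    | c y' s' where "y = c # y'" "s = c # s'" "s' \<in> shuffles y' (a # r @ t)"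
    by (cases s; cases y) (auto simp: Cons_in_shuffles_iff)
  then show ?case
  proof cases
    case 1
    with IH show ?thesis by auto
  next
    case 2
    show ?thesis
    proof (cases "c < a")
      case True
      with 2 append_in_shuffles[of y t] show ?thesis by (intro bexI[of _ "y @ t"]) auto
    next
      case False
      with y_le 2(1) have c: "c = a" "y' \<le> r" by auto
      have "y' \<le> r @ t" using c(2) le_append order_trans by blast
      moreover have "s' \<in> shuffles ([a] @ (r @ t)) y'"
        using 2(3) by (simp add: shuffles_commutes)
      ultimately obtain s'' where s'': "s'' \<in> shuffles (r @ t) ([a] @ y')" "s' \<le> s''"
        by (meson shuffles_move_to_smaller)
      then have "s'' \<in> shuffles y (r @ t)" using 2(1) c by (simp add: shuffles_commutes)
      with IH s''(2) obtain t' where "t' \<in> shuffles y t" "s' \<le> r @ t'"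
        using order_trans by blast
      with 2(2) c show ?thesis by auto
    qed
  qed
qed

fun multi_shuffles :: "'a list list \<Rightarrow> 'a list set" where
  "multi_shuffles [] = {[]}"
| "multi_shuffles (l # ls) = (\<Union>v\<in>multi_shuffles ls. shuffles l v)"

lemma concat_in_multi_shuffles: "concat ls \<in> multi_shuffles ls"
  by (induction ls) (auto intro: append_in_shuffles)

lemma mset_multi_shuffles: "s \<in> multi_shuffles ls \<Longrightarrow> mset s = mset (concat ls)"
  by (induction ls arbitrary: s) (auto dest: mset_shuffles)

text \<open>The word \<open>r\<close> is moved to the front past one factor of the list after the other.\<close>

lemma multi_shuffles_le_prefix_first:
  assumes "\<And>p q l. r = p @ q \<Longrightarrow> q \<noteq> [] \<Longrightarrow> l \<in> set ls \<Longrightarrow> l \<le> q"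
    and "s \<in> multi_shuffles (r # ls)"
  shows "\<exists>t\<in>multi_shuffles ls. s \<le> r @ (t :: 'a::linorder list)"
  using assms
proof (induction ls arbitrary: s)
  case (Cons l ls)
  from Cons.prems(2) obtain v v' where "s \<in> shuffles r v" "v \<in> shuffles l v'" "v' \<in> multi_shuffles ls"
    by auto
  then obtain s2 where s2: "s2 \<in> shuffles r v'" "s \<in> shuffles l s2"
    using shuffles_left_commute by blast
  with \<open>v' \<in> _\<close> have "s2 \<in> multi_shuffles (r # ls)" by auto
  with Cons.IH Cons.prems(1) obtain t' where t': "t' \<in> multi_shuffles ls" "s2 \<le> r @ t'"
    by (metis list.set_intros(2))
  obtain s3 where s3: "s3 \<in> shuffles l (r @ t')" "s \<le> s3"
    using shuffles_mono_right[OF t'(2) s2(2)] by blast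
  have "\<exists>t\<in>shuffles l t'. s3 \<le> r @ t"
    using Cons.prems(1) s3(1) by (intro shuffles_le_prefix_first) auto
  with s3(2) t'(1) show ?case by (auto intro: order_trans)
qed simp

section \<open>Lyndon words\<close>

abbreviation Lyndon :: "'a::linorder list \<Rightarrow> bool" where
  "Lyndon \<equiv> lyndon {(x, y). x < y}"

lemma Lyndon_iff:
  "Lyndon w \<longleftrightarrow> w \<noteq> [] \<and> (\<forall>u v. w = u @ v \<longrightarrow> u \<noteq> [] \<longrightarrow> v \<noteq> [] \<longrightarrow> w < v)"
  by (simp add: lyndon_def list_less_def)

lemma Lyndon_le_suffix: "Lyndon (u @ v) \<Longrightarrow> v \<noteq> [] \<Longrightarrow> u @ v \<le> v"
  by (cases "u = []") (auto simp: Lyndon_iff intro: less_imp_le)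

lemma Lyndon_singleton: "Lyndon [x]"
  by (auto simp: Lyndon_iff Cons_eq_append_conv)

text \<open>A proper suffix of \<open>uv\<close> is a suffix of \<open>v\<close>, or it is \<open>qv\<close> for a proper suffix \<open>q\<close> of \<open>u\<close>; in
  the second case \<open>u < q\<close> is decided within \<open>q\<close>, which is shorter than \<open>u\<close>. Hence it is enough to
  know \<open>uv < v\<close>.\<close>

lemma Lyndon_append:
  assumes "Lyndon u" "Lyndon v" "u < v"
  shows "Lyndon (u @ v)"
proof -
  \<comment> \<open>If \<open>v = ut\<close>, then \<open>v < t\<close> because \<open>v\<close> is Lyndon, and prefixing \<open>u\<close> gives the claim.\<close>
  have less_v: "u @ v < v"
  proof (cases "\<exists>t. v = u @ t")
    case True
    then obtain t where t: "v = u @ t" by blast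
    with assms(1,3) have "v < t"
      using assms(2) unfolding Lyndon_iff by (metis append.right_neutral less_irrefl)
    with t show ?thesis by (metis append_less_append_iff)
  next
    case False
    then show ?thesis using append_less_append_if_not_prefix[of u v v "[]"] assms(3) by simp
  qed
  have "u @ v < s" if "u @ v = p @ s" "p \<noteq> []" "s \<noteq> []" for p s
  proof -
    from that(1) consider
        q where "p = u @ q" "v = q @ s"
      | q where "u = p @ q" "s = q @ v"
      by (auto simp: append_eq_append_conv2)
    then show ?thesis
    proof cases
      case 1
      with assms(2) that(3) have "v \<le> s" by (metis Lyndon_le_suffix)
      with less_v show ?thesis by simp
    next
      case 2
      show ?thesis
      proof (cases "q = []")
        case True
        with 2 less_v show ?thesis by simp
      next
        case False
        with assms(1) 2(1) that(2) have "u < q" unfolding Lyndon_iff by blast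
        moreover have "length q < length u" using 2(1) that(2) by simp
        then have "\<nexists>t. q = u @ t" by auto
        ultimately show ?thesis unfolding 2(2) by (rule append_less_append_if_not_prefix)
      qed
    qed
  qed
  with assms(1) show ?thesis by (auto simp: Lyndon_iff)
qed

definition lyndon_factorization :: "'a::linorder list list \<Rightarrow> bool" where
  "lyndon_factorization ls \<longleftrightarrow> sorted_wrt (\<ge>) ls \<and> (\<forall>l\<in>set ls. Lyndon l)"

lemma lyndon_factorization_Cons:
  "lyndon_factorization (l # ls) \<longleftrightarrow> Lyndon l \<and> (\<forall>m\<in>set ls. m \<le> l) \<and> lyndon_factorization ls"
  by (auto simp: lyndon_factorization_def)

text \<open>Letters are Lyndon words, and a Lyndon word put in front of a factorization absorbs its neighbours
  until the sequence is nonincreasing again.\<close>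

lemma ex_lyndon_factorization: "\<exists>ls. lyndon_factorization ls \<and> concat ls = w"
proof (induction w)
  case Nil
  show ?case by (intro exI[of _ "[]"]) (simp add: lyndon_factorization_def)
next
  case (Cons x w)
  have absorb: "\<exists>ls'. lyndon_factorization ls' \<and> concat ls' = l @ concat ls"
    if "Lyndon l" "lyndon_factorization ls" for l :: "'a list" and ls
    using that
  proof (induction ls arbitrary: l)
    case Nil
    then show ?case by (intro exI[of _ "[l]"]) (simp add: lyndon_factorization_def)
  next
    case (Cons m ls)
    show ?case
    proof (cases "l < m")
      case True
      with Cons.prems have "Lyndon (l @ m)"
        by (intro Lyndon_append) (auto simp: lyndon_factorization_Cons)
      with Cons.IH[of "l @ m"] Cons.prems(2) show ?thesis
        by (simp add: lyndon_factorization_Cons)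
    next
      case False
      with Cons.prems show ?thesis
        by (intro exI[of _ "l # m # ls"]) (auto simp: lyndon_factorization_Cons)
    qed
  qed
  from Cons absorb[OF Lyndon_singleton[of x]] show ?case by fastforce
qed

lemma prefix_of_concat_ends_in_factor:
  assumes "concat ls = u @ v" "u \<noteq> []" "\<forall>l\<in>set ls. l \<noteq> []"
  shows "\<exists>p s t. u = p @ s \<and> s \<noteq> [] \<and> s @ t \<in> set ls"
  using assms
proof (induction ls arbitrary: u)
  case (Cons l ls)
  from Cons.prems(1) consider
      q where "l = u @ q"
    | q where "u = l @ q" "concat ls = q @ v"
    by (auto simp: append_eq_append_conv2)
  then show ?case
  proof cases
    case 1
    with Cons.prems(2) show ?thesis by (intro exI[of _ "[]"] exI[of _ u] exI[of _ q]) simp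
  next
    case 2
    show ?thesis
    proof (cases "q = []")
      case True
      with 2 Cons.prems(3) have "u = [] @ l \<and> l \<noteq> [] \<and> l @ [] \<in> set (l # ls)" by simp
      then show ?thesis by blast
    next
      case False
      with Cons.IH[OF 2(2)] Cons.prems(3) obtain p s t
        where "q = p @ s" "s \<noteq> []" "s @ t \<in> set ls" by auto
      with 2(1) have "u = (l @ p) @ s \<and> s \<noteq> [] \<and> s @ t \<in> set (l # ls)" by simp
      then show ?thesis by blast
    qed
  qed
qed simp

text \<open>The first factor is the longest Lyndon prefix. A longer Lyndon prefix \<open>m\<close> would end in a nonempty
  prefix \<open>s\<close> of a later factor \<open>k\<close>, and then \<open>m < s \<le> k \<le> l \<le> m\<close>.\<close>

lemma Lyndon_prefix_length_le:
  assumes "lyndon_factorization (l # ls)" "Lyndon m" "concat (l # ls) = m @ v"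
  shows "length m \<le> length l"
proof (rule ccontr)
  assume "\<not> length m \<le> length l"
  with assms(3) obtain q where q: "m = l @ q" "concat ls = q @ v" "q \<noteq> []"
    by (auto simp: append_eq_append_conv2)
  obtain p s t where pst: "q = p @ s" "s \<noteq> []" "s @ t \<in> set ls"
    using prefix_of_concat_ends_in_factor[OF q(2,3)] assms(1)
    by (auto simp: lyndon_factorization_def Lyndon_iff)
  have "l \<noteq> []" using assms(1) by (simp add: lyndon_factorization_Cons Lyndon_iff)
  then have "m < s" using assms(2) q(1) pst(1,2) unfolding Lyndon_iff
    by (metis append_assoc append_is_Nil_conv)
  also have "s \<le> s @ t" by simp
  also have "s @ t \<le> l" using assms(1) pst(3) by (simp add: lyndon_factorization_Cons)
  also have "l \<le> m" by (simp add: q(1))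
  finally show False by simp
qed

lemma lyndon_factorization_unique:
  assumes "lyndon_factorization ls" "lyndon_factorization ms" "concat ls = concat ms"
  shows "ls = ms"
  using assms
proof (induction ls arbitrary: ms)
  case Nil
  then show ?case by (cases ms) (auto simp: lyndon_factorization_Cons Lyndon_iff)
next
  case (Cons l ls)
  then obtain m ms' where ms: "ms = m # ms'"
    by (cases ms) (auto simp: lyndon_factorization_Cons Lyndon_iff)
  have "length m \<le> length l"
    using Cons.prems ms by (intro Lyndon_prefix_length_le[of l ls m "concat ms'"])
      (auto simp: lyndon_factorization_Cons)
  moreover have "length l \<le> length m"
    using Cons.prems ms by (intro Lyndon_prefix_length_le[of m ms' l "concat ls"])
      (auto simp: lyndon_factorization_Cons)
  ultimately have "l = m \<and> concat ls = concat ms'"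
    using Cons.prems(3) ms by simp
  with Cons ms show ?case by (auto simp: lyndon_factorization_Cons)
qed

text \<open>The triangularity behind Radford's theorem. The suffixes of the first factor \<open>l\<close> are at least \<open>l\<close>,
  hence at least every other factor, so \<open>l\<close> can be placed in front and induction applies to the rest.\<close>

theorem multi_shuffles_le_concat:
  assumes "lyndon_factorization ls" "s \<in> multi_shuffles ls"
  shows "s \<le> concat ls"
  using assms
proof (induction ls arbitrary: s)
  case (Cons l ls)
  have "\<exists>t\<in>multi_shuffles ls. s \<le> l @ t"
  proof (rule multi_shuffles_le_prefix_first[OF _ Cons.prems(2)])
    fix p q m
    assume "l = p @ q" "q \<noteq> []" "m \<in> set ls"
    then show "m \<le> q"
      using Cons.prems(1) Lyndon_le_suffix[of p q]
      by (auto simp: lyndon_factorization_Cons intro: order_trans)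
  qed
  then obtain t where "t \<in> multi_shuffles ls" "s \<le> l @ t" by blast
  moreover from this(1) have "t \<le> concat ls"
    using Cons by (simp add: lyndon_factorization_Cons)
  then have "l @ t \<le> l @ concat ls" by simp
  ultimately show ?case by (simp add: order_trans)
qed simp

section \<open>Linear combinations of words\<close>

lemma lookup_basis: "Poly_Mapping.lookup (basis b) c = (if b = c then 1 else 0)"
  by (simp add: basis_def lookup_single when_def)

lemma keys_basis [simp]: "Poly_Mapping.keys (basis b :: 'b \<Rightarrow>\<^sub>0 'k::field) = {b}"
  by (simp add: basis_def)

lemma lin_ext_basis_id: "lin_ext basis p = p"
  by (induction p rule: free_induct) (simp_all add: lin_ext_add lin_ext_scale)

lemma lin_ext_mem:
  assumes "free.subspace S" "\<And>b. b \<in> Poly_Mapping.keys p \<Longrightarrow> g b \<in> S"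
  shows "lin_ext g p \<in> S"
  unfolding lin_ext_def using assms by (intro free.subspace_sum free.subspace_scale)

lemma bilin_ext_mem:
  assumes "free.subspace S"
    and "\<And>a b. a \<in> Poly_Mapping.keys p \<Longrightarrow> b \<in> Poly_Mapping.keys q \<Longrightarrow> g a b \<in> S"
  shows "bilin_ext g p q \<in> S"
  unfolding bilin_ext_def using assms by (intro lin_ext_mem)

lemma subspace_supported_on: "free.subspace (supported_on B :: ('b \<Rightarrow>\<^sub>0 'k::field) set)"
proof (rule free.subspaceI)
  show "p + q \<in> supported_on B" if "p \<in> supported_on B" "q \<in> supported_on B"
    for p q :: "'b \<Rightarrow>\<^sub>0 'k"
    using that keys_add[of p q] by (auto simp: supported_on_def)
qed (auto simp: supported_on_def in_keys_iff)

lemma basis_in_supported_on: "basis b \<in> supported_on B \<longleftrightarrow> b \<in> B"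
  by (simp add: supported_on_def)

lemma supported_on_subset:
  fixes S :: "('b \<Rightarrow>\<^sub>0 'k::field) set"
  assumes "free.subspace S" "\<And>b. b \<in> B \<Longrightarrow> basis b \<in> S"
  shows "supported_on B \<subseteq> S"
proof
  fix p :: "'b \<Rightarrow>\<^sub>0 'k" assume "p \<in> supported_on B"
  then have "lin_ext basis p \<in> S"
    using assms by (intro lin_ext_mem) (auto simp: supported_on_def)
  then show "p \<in> S" by (simp add: lin_ext_basis_id)
qed

text \<open>The elimination step for triangular systems.\<close>

lemma basis_mem_if_other_keys_mem:
  assumes "free.subspace S" "p \<in> S" "b \<in> Poly_Mapping.keys p"
    and "\<And>c. c \<in> Poly_Mapping.keys p \<Longrightarrow> c \<noteq> b \<Longrightarrow> basis c \<in> S"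
  shows "basis b \<in> S"
proof -
  let ?c = "\<lambda>b. Poly_Mapping.lookup p b"
  have "p = (\<Sum>a\<in>Poly_Mapping.keys p. scale (?c a) (basis a))"
    using lin_ext_basis_id[of p] by (simp add: lin_ext_def)
  also have "\<dots> = scale (?c b) (basis b) + (\<Sum>a\<in>Poly_Mapping.keys p - {b}. scale (?c a) (basis a))"
    using assms(3) by (simp add: sum.remove)
  finally have "scale (?c b) (basis b) = p - (\<Sum>a\<in>Poly_Mapping.keys p - {b}. scale (?c a) (basis a))"
    by (simp add: algebra_simps)
  also have "\<dots> \<in> S"
    using assms by (intro free.subspace_diff free.subspace_sum free.subspace_scale) auto
  finally have "scale (1 / ?c b) (scale (?c b) (basis b)) \<in> S"
    by (rule free.subspace_scale[OF assms(1)])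
  with assms(3) show ?thesis by (simp add: in_keys_iff)
qed

lemma shuffle_mem:
  assumes "free.subspace S"
    and "\<And>u v. u \<in> Poly_Mapping.keys p \<Longrightarrow> v \<in> Poly_Mapping.keys q \<Longrightarrow> shuffle_words u v \<in> S"
  shows "shuffle p q \<in> S"
  unfolding shuffle_def using assms by (rule bilin_ext_mem)

lemma bullet_mem:
  assumes "free.subspace S"
    and "\<And>u v. u \<in> Poly_Mapping.keys p \<Longrightarrow> v \<in> Poly_Mapping.keys q \<Longrightarrow> bullet_words f u v \<in> S"
  shows "bullet f p q \<in> S"
  unfolding bullet_def using assms by (rule bilin_ext_mem)

lemma cons_vec_basis_mem:
  assumes "free.subspace S" "\<And>v. v \<in> Poly_Mapping.keys p \<Longrightarrow> basis (x # v) \<in> S"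
  shows "cons_vec (basis x) p \<in> S"
  unfolding cons_vec_def using assms by (intro bilin_ext_mem) auto

lemma lookup_cons_vec_basis:
  "Poly_Mapping.lookup (cons_vec (basis x) p) w =
     (case w of [] \<Rightarrow> 0 | y # v \<Rightarrow> if y = x then Poly_Mapping.lookup p v else 0)"
  by (induction p rule: free_induct)
    (auto simp: bilin_simps product_basis lookup_add lookup_basis split: list.splits)

section \<open>The shuffle product\<close>

lemma shuffle_commute: "shuffle p q = shuffle q p"
proof -
  have words: "shuffle_words u v = (shuffle_words v u :: ('x, 'k::field) tensor)" for u v :: "'x list"
  proof (induction u v rule: shuffle_words.induct)
    case (1 v)
    then show ?case by (cases v) simp_all
  qed (simp_all add: add.commute)
  have basis: "shuffle (basis u) q = shuffle q (basis u)" for u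
    by (induction q rule: free_induct) (simp_all add: bilin_simps product_basis words[of u])
  show ?thesis
    by (induction p rule: free_induct) (simp_all add: bilin_simps basis)
qed

lemma shuffle_assoc: "shuffle (shuffle p q) r = shuffle p (shuffle q r)"
proof -
  have words: "shuffle (shuffle (basis u) (basis v)) (basis w) =
      (shuffle (basis u) (shuffle (basis v) (basis w)) :: ('x, 'k::field) tensor)"
    for u v w :: "'x list"
  proof (induction "length u + length v + length w" arbitrary: u v w rule: less_induct)
    case less
    show ?case
    proof (cases "u = [] \<or> v = [] \<or> w = []")
      case True
      then show ?thesis by (auto simp: shuffle_Nil)
    next
      case False
      then obtain x u' y v' z w' where eq: "u = x # u'" "v = y # v'" "w = z # w'"
        by (metis neq_Nil_conv)
      let ?x = "basis x" and ?y = "basis y" and ?z = "basis z"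
      let ?u = "basis u'" and ?v = "basis v'" and ?w = "basis w'"
      have IH:
        "shuffle (shuffle ?u (cons_vec ?y ?v)) (cons_vec ?z ?w) =
           (shuffle ?u (shuffle (cons_vec ?y ?v) (cons_vec ?z ?w)) :: ('x, 'k) tensor)"
        "shuffle (shuffle (cons_vec ?x ?u) ?v) (cons_vec ?z ?w) =
           (shuffle (cons_vec ?x ?u) (shuffle ?v (cons_vec ?z ?w)) :: ('x, 'k) tensor)"
        "shuffle (shuffle (cons_vec ?x ?u) (cons_vec ?y ?v)) ?w =
           (shuffle (cons_vec ?x ?u) (shuffle (cons_vec ?y ?v) ?w) :: ('x, 'k) tensor)"
        using less[of u' v w] less[of u v' w] less[of u v w'] eq
        by (simp_all add: product_basis(1))
      have b: "basis u = (cons_vec ?x ?u :: ('x, 'k) tensor)" "basis v = (cons_vec ?y ?v :: ('x, 'k) tensor)"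
        "basis w = (cons_vec ?z ?w :: ('x, 'k) tensor)"
        by (simp_all add: eq product_basis(1))
      have "shuffle (shuffle (cons_vec ?x ?u) (cons_vec ?y ?v)) (cons_vec ?z ?w) =
          (cons_vec ?x (shuffle (shuffle ?u (cons_vec ?y ?v)) (cons_vec ?z ?w)) +
           cons_vec ?y (shuffle (shuffle (cons_vec ?x ?u) ?v) (cons_vec ?z ?w)) +
           cons_vec ?z (shuffle (shuffle (cons_vec ?x ?u) (cons_vec ?y ?v)) ?w)
           :: ('x, 'k) tensor)"
        by (simp add: shuffle_cons_vec bilin_simps add_ac)
      also have "\<dots> = shuffle (cons_vec ?x ?u) (shuffle (cons_vec ?y ?v) (cons_vec ?z ?w))"
        unfolding IH by (simp add: shuffle_cons_vec bilin_simps add_ac)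
      finally show ?thesis unfolding b .
    qed
  qed
  have 2: "shuffle (shuffle (basis u) (basis v)) r = shuffle (basis u) (shuffle (basis v) r)" for u v
    by (induction r rule: free_induct) (simp_all add: bilin_simps words)
  have 1: "shuffle (shuffle (basis u) q) r = shuffle (basis u) (shuffle q r)" for u
    by (induction q rule: free_induct) (simp_all add: bilin_simps 2)
  show ?thesis
    by (induction p rule: free_induct) (simp_all add: bilin_simps 1)
qed

lemma shuffle_left_commute: "shuffle p (shuffle q r) = shuffle q (shuffle p r)"
  by (metis shuffle_assoc shuffle_commute)

text \<open>All coefficients are natural numbers, nonzero precisely on \<open>S\<close>. Since nothing can cancel in
  characteristic zero, supports of shuffle products are computed by the shuffles of words as sets.\<close>

definition nat_coeffs :: "'x list set \<Rightarrow> ('x, 'k::field_char_0) tensor \<Rightarrow> bool" where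
  "nat_coeffs S p \<longleftrightarrow> (\<forall>w. \<exists>n. Poly_Mapping.lookup p w = of_nat n \<and> (n \<noteq> 0 \<longleftrightarrow> w \<in> S))"

lemma nat_coeffs_basis: "nat_coeffs {w} (basis w)"
  unfolding nat_coeffs_def lookup_basis by (metis of_nat_0 of_nat_1 one_neq_zero singleton_iff)

lemma nat_coeffs_add:
  assumes "nat_coeffs S p" "nat_coeffs S' q"
  shows "nat_coeffs (S \<union> S') (p + q)"
  unfolding nat_coeffs_def
proof
  fix w
  obtain m n where "Poly_Mapping.lookup p w = of_nat m" "m \<noteq> 0 \<longleftrightarrow> w \<in> S"
    "Poly_Mapping.lookup q w = of_nat n" "n \<noteq> 0 \<longleftrightarrow> w \<in> S'"
    using assms unfolding nat_coeffs_def by metis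
  then show "\<exists>n. Poly_Mapping.lookup (p + q) w = of_nat n \<and> (n \<noteq> 0 \<longleftrightarrow> w \<in> S \<union> S')"
    by (intro exI[of _ "m + n"]) (auto simp: lookup_add)
qed

lemma nat_coeffs_cons_vec: "nat_coeffs S p \<Longrightarrow> nat_coeffs ((#) x ` S) (cons_vec (basis x) p)"
  unfolding nat_coeffs_def lookup_cons_vec_basis
  by (intro allI, rename_tac w, case_tac w) (auto intro: exI[of _ 0])

lemma keys_nat_coeffs: "nat_coeffs S p \<Longrightarrow> Poly_Mapping.keys p = S"
  unfolding nat_coeffs_def set_eq_iff in_keys_iff by (metis of_nat_eq_0_iff)

lemma nat_coeffs_shuffle_words: "nat_coeffs (shuffles u v) (shuffle_words u v)"
  by (induction u v rule: shuffle_words.induct)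
    (auto simp: nat_coeffs_basis intro: nat_coeffs_add nat_coeffs_cons_vec)

lemma nat_coeffs_shuffle_basis:
  fixes p :: "('x, 'k::field_char_0) tensor"
  assumes "nat_coeffs S p"
  shows "nat_coeffs (\<Union>v\<in>S. shuffles u v) (shuffle (basis u) p)"
  unfolding nat_coeffs_def
proof
  fix w
  obtain n where n: "Poly_Mapping.lookup p v = of_nat (n v)" "n v \<noteq> 0 \<longleftrightarrow> v \<in> S" for v
    using assms unfolding nat_coeffs_def by metis
  have "\<forall>v. \<exists>m. Poly_Mapping.lookup (shuffle_words u v :: ('x, 'k) tensor) w = of_nat m
      \<and> (m \<noteq> 0 \<longleftrightarrow> w \<in> shuffles u v)"
    using nat_coeffs_shuffle_words unfolding nat_coeffs_def by blast
  from choice[OF this] obtain m where m: "Poly_Mapping.lookup (shuffle_words u v :: ('x, 'k) tensor) w = of_nat (m v)"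
      "m v \<noteq> 0 \<longleftrightarrow> w \<in> shuffles u v" for v
    by blast
  have keys: "Poly_Mapping.keys p = S" using assms by (rule keys_nat_coeffs)
  then have fin: "finite S" by (metis finite_keys)
  have "shuffle (basis u) p = (\<Sum>v\<in>S. scale (of_nat (n v)) (shuffle_words u v))"
    by (simp add: shuffle_def bilin_ext_def) (simp add: lin_ext_def keys n)
  then have "Poly_Mapping.lookup (shuffle (basis u) p) w = of_nat (\<Sum>v\<in>S. n v * m v)"
    by (simp add: lookup_sum m)
  moreover have "(\<Sum>v\<in>S. n v * m v) \<noteq> 0 \<longleftrightarrow> w \<in> (\<Union>v\<in>S. shuffles u v)"
    using fin n(2) m(2) by auto
  ultimately show "\<exists>n. Poly_Mapping.lookup (shuffle (basis u) p) w = of_nat n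
      \<and> (n \<noteq> 0 \<longleftrightarrow> w \<in> (\<Union>v\<in>S. shuffles u v))"
    by metis
qed

section \<open>Shuffle monomials in Lyndon words\<close>

definition shuffle_monomial :: "'x list list \<Rightarrow> ('x, 'k::field) tensor" where
  "shuffle_monomial ls = foldr (\<lambda>l. shuffle (basis l)) ls (basis [])"

lemma shuffle_monomial_simps [simp]:
  "shuffle_monomial [] = basis []"
  "shuffle_monomial (l # ls) = shuffle (basis l) (shuffle_monomial ls)"
  by (simp_all add: shuffle_monomial_def)

lemma shuffle_monomial_append:
  "shuffle_monomial (ls @ ms) = shuffle (shuffle_monomial ls) (shuffle_monomial ms)"
  by (induction ls) (simp_all add: shuffle_Nil shuffle_assoc)

text \<open>Since the product is commutative, a product of two monomials can be sorted into a monomial of a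
  nonincreasing sequence.\<close>

lemma shuffle_monomial_mset:
  assumes "mset ls = mset ms"
  shows "shuffle_monomial ls = (shuffle_monomial ms :: ('x, 'k::field) tensor)"
proof -
  let ?f = "\<lambda>l. shuffle (basis l :: ('x, 'k) tensor)"
  have "fold ?f (rev ls) = fold ?f (rev ms)"
    by (rule fold_multiset_equiv) (use assms in \<open>auto simp: fun_eq_iff shuffle_left_commute\<close>)
  then show ?thesis by (simp add: shuffle_monomial_def foldr_conv_fold)
qed

lemma keys_shuffle_monomial:
  "Poly_Mapping.keys (shuffle_monomial ls :: ('x, 'k::field_char_0) tensor) = multi_shuffles ls"
proof -
  have "nat_coeffs (multi_shuffles ls) (shuffle_monomial ls :: ('x, 'k) tensor)"
    by (induction ls) (auto intro: nat_coeffs_basis nat_coeffs_shuffle_basis)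
  then show ?thesis by (rule keys_nat_coeffs)
qed

text \<open>Radford's theorem, spanning part. Among the rearrangements of \<open>w\<close> outside \<open>S\<close> let \<open>v\<close> be the
  smallest. The monomial of its Lyndon factorization lies in \<open>S\<close> and has \<open>v\<close> as leading word; its
  other words are smaller rearrangements, so they lie in \<open>S\<close>, and hence so does \<open>v\<close>.\<close>

lemma basis_mem_shuffle_closed:
  fixes S :: "('x::linorder, 'k::field_char_0) tensor set"
  assumes S: "free.subspace S" "basis [] \<in> S"
    and shuffle: "\<And>p q. p \<in> S \<Longrightarrow> q \<in> S \<Longrightarrow> shuffle p q \<in> S"
    and lyndon: "\<And>l. l \<in> lists A \<Longrightarrow> Lyndon l \<Longrightarrow> basis l \<in> S"
    and w: "w \<in> lists A"
  shows "basis w \<in> S"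
proof (rule ccontr)
  assume bad: "basis w \<notin> S"
  let ?Bad = "{v. mset v = mset w \<and> basis v \<notin> S}"
  have fin: "finite ?Bad" by (rule finite_subset[OF _ mset_eq_finite[of w]]) auto
  moreover have "?Bad \<noteq> {}" using bad by blast
  ultimately have "Min ?Bad \<in> ?Bad" by (rule Min_in)
  moreover define v where "v = Min ?Bad"
  ultimately have v: "mset v = mset w" "basis v \<notin> S" by simp_all
  have v_min: "v \<le> u" if "mset u = mset w" "basis u \<notin> S" for u
    unfolding v_def by (rule Min_le[OF fin]) (simp add: that)
  obtain ls where ls: "lyndon_factorization ls" "concat ls = v"
    using ex_lyndon_factorization by blast
  have "set v \<subseteq> A" using v(1) w by (metis in_listsD mset_eq_setD subsetI)
  then have letters: "set l \<subseteq> A" if "l \<in> set ls" for l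
    using that unfolding ls(2)[symmetric] set_concat by blast
  have "basis l \<in> S" if "l \<in> set ls" for l
  proof (rule lyndon)
    show "l \<in> lists A" using letters[OF that] by (simp add: in_lists_conv_set subset_iff)
    show "Lyndon l" using ls(1) that by (simp add: lyndon_factorization_def)
  qed
  then have "shuffle_monomial ls \<in> S" by (induction ls) (simp_all add: S shuffle)
  then have "basis v \<in> S"
  proof (rule basis_mem_if_other_keys_mem[OF S(1)])
    show "v \<in> Poly_Mapping.keys (shuffle_monomial ls :: ('x, 'k) tensor)"
      using concat_in_multi_shuffles[of ls] by (simp add: keys_shuffle_monomial ls(2))
    fix u assume "u \<in> Poly_Mapping.keys (shuffle_monomial ls :: ('x, 'k) tensor)" "u \<noteq> v"
    then have "u \<in> multi_shuffles ls" by (simp add: keys_shuffle_monomial)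
    with \<open>u \<noteq> v\<close> have "u < v" "mset u = mset w"
      using multi_shuffles_le_concat[OF ls(1)] mset_multi_shuffles[of u ls] ls(2) v(1)
      by (auto simp: order.strict_iff_order)
    then show "basis u \<in> S" using v_min by (meson leD)
  qed
  with v(2) show False by contradiction
qed

text \<open>Radford's theorem, independence part. The largest of the concatenations occurs in one monomial
  only, for otherwise it would also be the leading word of another one, against the uniqueness of
  Lyndon factorizations.\<close>

lemma shuffle_monomials_leading_coeff:
  assumes "finite F" "F \<noteq> {}" "\<And>ls. ls \<in> F \<Longrightarrow> lyndon_factorization ls"
    and "\<And>ls. ls \<in> F \<Longrightarrow> c ls \<noteq> 0"
  shows "\<exists>ls\<in>F. Poly_Mapping.lookup (\<Sum>ms\<in>F. scale (c ms) (shuffle_monomial ms))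
    (concat ls) \<noteq> (0 :: 'k::field_char_0)"
proof -
  have "Max (concat ` F) \<in> concat ` F" using assms by (intro Max_in) auto
  then obtain ls where ls: "ls \<in> F" "concat ls = Max (concat ` F)" by auto
  let ?x = "\<lambda>ms. Poly_Mapping.lookup (shuffle_monomial ms :: ('a, 'k) tensor) (concat ls)"
  have zero: "?x ms = 0" if "ms \<in> F" "ms \<noteq> ls" for ms
  proof (rule ccontr)
    assume "?x ms \<noteq> 0"
    then have "concat ls \<in> multi_shuffles ms"
      by (simp add: keys_shuffle_monomial[symmetric, where 'k = 'k] in_keys_iff)
    then have "concat ls \<le> concat ms" using multi_shuffles_le_concat assms(3) that(1) by blast
    moreover have "concat ms \<le> concat ls" using ls(2) that(1) assms(1) by simp
    ultimately have "ms = ls"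
      using assms(3) that(1) ls(1) by (intro lyndon_factorization_unique) auto
    with that(2) show False by contradiction
  qed
  have "Poly_Mapping.lookup (\<Sum>ms\<in>F. scale (c ms) (shuffle_monomial ms)) (concat ls) =
      (\<Sum>ms\<in>F. c ms * ?x ms)"
    by (simp add: lookup_sum)
  also have "\<dots> = c ls * ?x ls"
    using assms(1) ls(1) zero by (simp add: sum.remove[of F ls])
  also have "\<dots> \<noteq> 0"
    using concat_in_multi_shuffles[of ls] assms(4) ls(1)
    by (simp add: keys_shuffle_monomial[symmetric, where 'k = 'k] in_keys_iff)
  finally show ?thesis using ls(1) by blast
qed

text \<open>A combination of the other monomials can be told from the monomial \<open>l\<close> by its coefficient at a
  concatenation of one of the sequences involved. Naming that word allows the comparison to be made
  modulo the words of positive weight.\<close>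

lemma Lyndon_word_not_in_span:
  fixes l :: "'x::linorder list"
  assumes "Lyndon l" "\<And>ls. ls \<in> F \<Longrightarrow> lyndon_factorization ls" "[l] \<notin> F"
    and "q \<in> free.span (shuffle_monomial ` F)"
  shows "\<exists>ls\<in>insert [l] F. Poly_Mapping.lookup q (concat ls) \<noteq>
    (Poly_Mapping.lookup (basis l) (concat ls) :: 'k::field_char_0)"
proof -
  from assms(4) obtain B r where B: "finite B" "B \<subseteq> shuffle_monomial ` F"
    and q: "q = (\<Sum>a\<in>B. scale (r a) a)"
    unfolding free.span_explicit by blast
  from B(2) obtain G where G: "G \<subseteq> F" "B = shuffle_monomial ` G"
      "inj_on (shuffle_monomial :: 'x list list \<Rightarrow> ('x, 'k) tensor) G"
    using subset_image_inj[of B shuffle_monomial F] by blast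
  then have "finite G" using B(1) by (metis finite_imageD)
  \<comment> \<open>The coefficients of the combination \<open>l - q\<close> of monomials; the coefficient of \<open>l\<close> is 1.\<close>
  let ?c = "\<lambda>ls. if ls = [l] then 1 else - r (shuffle_monomial ls)"
  let ?F = "{ls \<in> insert [l] G. ?c ls \<noteq> 0}"
  have nl: "[l] \<notin> G" using G(1) assms(3) by blast
  have q': "q = (\<Sum>ls\<in>G. scale (r (shuffle_monomial ls)) (shuffle_monomial ls))"
    unfolding q G(2) by (simp add: sum.reindex[OF G(3)])
  have "(\<Sum>ls\<in>?F. scale (?c ls) (shuffle_monomial ls)) =
      (\<Sum>ls\<in>insert [l] G. scale (?c ls) (shuffle_monomial ls))"
    using \<open>finite G\<close> by (intro sum.mono_neutral_left) auto
  also have "\<dots> = basis l + (\<Sum>ls\<in>G. scale (?c ls) (shuffle_monomial ls))"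
    using \<open>finite G\<close> nl by (simp add: shuffle_Nil)
  also have "(\<Sum>ls\<in>G. scale (?c ls) (shuffle_monomial ls)) = - q"
  proof -
    have "(\<Sum>ls\<in>G. scale (?c ls) (shuffle_monomial ls)) =
        (\<Sum>ls\<in>G. - scale (r (shuffle_monomial ls)) (shuffle_monomial ls))"
      using nl by (intro sum.cong) auto
    then show ?thesis by (simp add: q' sum_negf)
  qed
  finally have eq: "(\<Sum>ls\<in>?F. scale (?c ls) (shuffle_monomial ls)) = basis l - q" by simp
  have "\<exists>ls\<in>?F. Poly_Mapping.lookup (\<Sum>ms\<in>?F. scale (?c ms) (shuffle_monomial ms))
      (concat ls) \<noteq> (0 :: 'k)"
  proof (rule shuffle_monomials_leading_coeff)
    show "lyndon_factorization ls" if "ls \<in> ?F" for ls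
      using that assms(1,2) G(1) by (auto simp: lyndon_factorization_def)
  qed (use \<open>finite G\<close> in auto)
  then obtain ls where "ls \<in> ?F" "Poly_Mapping.lookup (basis l - q) (concat ls) \<noteq> 0"
    unfolding eq by blast
  with G(1) show ?thesis by (intro bexI[of _ ls]) (auto simp: lookup_minus)
qed

section \<open>The weight grading\<close>

definition weight :: "(nat \<times> 'd) list \<Rightarrow> nat" where
  "weight w = sum_list (map fst w)"

lemma weight_simps [simp]:
  "weight [] = 0" "weight (x # w) = fst x + weight w" "weight (u @ v) = weight u + weight v"
  by (simp_all add: weight_def)

lemma weight_concat_eq_0_iff: "weight (concat ls) = 0 \<longleftrightarrow> (\<forall>l\<in>set ls. weight l = 0)"
  by (induction ls) auto

lemma weight_shuffles:
  assumes "w \<in> shuffles u v"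
  shows "weight w = weight u + weight v"
proof -
  have "weight w = (\<Sum>x\<in>#mset w. fst x)" for w :: "(nat \<times> 'a) list"
    unfolding weight_def by (metis mset_map sum_mset_sum_list)
  with assms show ?thesis by (simp add: mset_shuffles)
qed

definition words_of_weight :: "'d set \<Rightarrow> nat \<Rightarrow> (nat \<times> 'd) list set" where
  "words_of_weight D n = {w \<in> lists (biletters D). weight w = n}"

lemma words_of_weight_Cons:
  "(k, d) # w \<in> words_of_weight D n \<longleftrightarrow> d \<in> D \<and> k \<le> n \<and> w \<in> words_of_weight D (n - k)"
  by (auto simp: words_of_weight_def biletters_def)

lemma words_of_weight_zero: "words_of_weight D 0 = lists (biletters0 D)"
proof -
  have "w \<in> words_of_weight D 0 \<longleftrightarrow> w \<in> lists (biletters0 D)" for w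
    by (induction w) (auto simp: words_of_weight_def biletters_def biletters0_def)
  then show ?thesis by blast
qed

lemma shuffles_words_of_weight:
  assumes "u \<in> words_of_weight D m" "v \<in> words_of_weight D n"
  shows "shuffles u v \<subseteq> words_of_weight D (m + n)"
proof
  fix w assume w: "w \<in> shuffles u v"
  then have "set w = set u \<union> set v" "weight w = weight u + weight v"
    by (simp_all add: set_shuffles weight_shuffles)
  with assms show "w \<in> words_of_weight D (m + n)"
    by (auto simp: words_of_weight_def)
qed

lemma keys_shuffle_words:
  "Poly_Mapping.keys (shuffle_words u v :: ('x, 'k::field_char_0) tensor) = shuffles u v"
  by (rule keys_nat_coeffs[OF nat_coeffs_shuffle_words])

lemma raise_basis: "raise (basis (k, d)) = basis (Suc k, d)"
  by (simp add: raise_def)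

lemma bullet_words_raise_Cons:
  "bullet_words raise ((k, d) # u) v =
     cons_vec (basis (k, d)) (bullet_words raise u v) + cons_vec (basis (Suc k, d)) (shuffle_words u v)"
  by (simp add: raise_basis)

lemma bullet_words_raise_letter: "bullet_words raise [(k, d)] v = basis ((Suc k, d) # v)"
  by (simp only: bullet_words_raise_Cons) (simp add: bilin_simps product_basis)

lemma bullet_words_raise_supported:
  assumes "u \<in> words_of_weight D m" "v \<in> words_of_weight D n"
  shows "(bullet_words raise u v :: (nat \<times> 'd, 'k::field_char_0) tensor)
    \<in> supported_on (words_of_weight D (Suc (m + n)))"
  using assms(1)
proof (induction u arbitrary: m)
  case Nil
  show ?case by (simp add: free.subspace_0[OF subspace_supported_on])
next
  case (Cons x u)
  obtain k d where x: "x = (k, d)" by (cases x)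
  from Cons.prems have u: "d \<in> D" "k \<le> m" "u \<in> words_of_weight D (m - k)"
    by (auto simp: x words_of_weight_Cons)
  have "cons_vec (basis (k, d)) (bullet_words raise u v :: (nat \<times> 'd, 'k) tensor)
      \<in> supported_on (words_of_weight D (Suc (m + n)))"
  proof (rule cons_vec_basis_mem[OF subspace_supported_on])
    fix w assume "w \<in> Poly_Mapping.keys (bullet_words raise u v :: (nat \<times> 'd, 'k) tensor)"
    then have "w \<in> words_of_weight D (Suc (m - k + n))"
      using Cons.IH[OF u(3)] by (auto simp: supported_on_def)
    with u show "basis ((k, d) # w) \<in> supported_on (words_of_weight D (Suc (m + n)))"
      by (simp add: basis_in_supported_on words_of_weight_Cons Suc_diff_le)
  qed
  moreover have "cons_vec (basis (Suc k, d)) (shuffle_words u v :: (nat \<times> 'd, 'k) tensor)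
      \<in> supported_on (words_of_weight D (Suc (m + n)))"
  proof (rule cons_vec_basis_mem[OF subspace_supported_on])
    fix w assume "w \<in> Poly_Mapping.keys (shuffle_words u v :: (nat \<times> 'd, 'k) tensor)"
    then have "w \<in> words_of_weight D (m - k + n)"
      using shuffles_words_of_weight[OF u(3) assms(2)] by (auto simp: keys_shuffle_words)
    with u show "basis ((Suc k, d) # w) \<in> supported_on (words_of_weight D (Suc (m + n)))"
      by (simp add: basis_in_supported_on words_of_weight_Cons)
  qed
  ultimately show ?case
    unfolding x bullet_words_raise_Cons by (rule free.subspace_add[OF subspace_supported_on])
qed

lemma bullet_raise_positive_weight:
  "(bullet raise p q :: (nat \<times> 'd, 'k::field_char_0) tensor) \<in> supported_on {w. weight w \<noteq> 0}"
proof (rule bullet_mem[OF subspace_supported_on])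
  fix u v :: "(nat \<times> 'd) list"
  have "w \<in> words_of_weight UNIV (weight w)" for w :: "(nat \<times> 'd) list"
    by (auto simp: words_of_weight_def biletters_def)
  then have "(bullet_words raise u v :: (nat \<times> 'd, 'k) tensor)
      \<in> supported_on (words_of_weight UNIV (Suc (weight u + weight v)))"
    using bullet_words_raise_supported by blast
  then show "(bullet_words raise u v :: (nat \<times> 'd, 'k) tensor) \<in> supported_on {w. weight w \<noteq> 0}"
    by (auto simp: supported_on_def words_of_weight_def)
qed

lemma lookup_bullet_raise:
  "weight w = 0 \<Longrightarrow> Poly_Mapping.lookup (bullet raise p q) w = (0 :: 'k::field_char_0)"
  using bullet_raise_positive_weight[of p q] by (auto simp: supported_on_def in_keys_iff)

lemma shuffle_positive_weight:
  assumes "(p :: (nat \<times> 'd, 'k::field_char_0) tensor) \<in> supported_on {w. weight w \<noteq> 0}"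
  shows "shuffle p q \<in> supported_on {w. weight w \<noteq> 0}"
proof (rule shuffle_mem[OF subspace_supported_on])
  fix u v assume "u \<in> Poly_Mapping.keys p"
  with assms have "weight u \<noteq> 0" by (auto simp: supported_on_def)
  then show "(shuffle_words u v :: (nat \<times> 'd, 'k) tensor) \<in> supported_on {w. weight w \<noteq> 0}"
    by (auto simp: supported_on_def keys_shuffle_words dest: weight_shuffles)
qed

section \<open>Generation by words of weight zero\<close>

text \<open>Words with a raised first letter are themselves products: \<open>f(y) w = y \<bullet> w\<close>. For a first
  letter \<open>x\<close> of weight zero, concatenation with \<open>x\<close> preserves the span because
  \<open>x (u \<bullet> v) = xu \<bullet> v - f(x) (u \<squnion> v)\<close>, and the words in the last term have a raised first letter.\<close>

lemma positive_weight_in_span_bullets: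
  assumes "w \<in> words_of_weight D (Suc m)"
  shows "(basis w :: (nat \<times> 'd, 'k::field_char_0) tensor) \<in> free.span
    {bullet_words raise u v | u v.
      u \<in> lists (biletters D) \<and> v \<in> lists (biletters D) \<and> weight u + weight v = m}"
    (is "_ \<in> free.span ?B")
  using assms
proof (induction w)
  case Nil
  then show ?case by (simp add: words_of_weight_def)
next
  case (Cons x w)
  obtain k d where x: "x = (k, d)" by (cases x)
  from Cons.prems have d: "d \<in> D" and w: "w \<in> lists (biletters D)" "k + weight w = Suc m"
    by (auto simp: x words_of_weight_def biletters_def)
  have raised: "basis ((Suc j, d) # v) \<in> free.span ?B"
    if "v \<in> lists (biletters D)" "j + weight v = m" for j v
  proof (rule free.span_base)
    have "[(j, d)] \<in> lists (biletters D)" using d by (simp add: biletters_def)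
    moreover have "weight [(j, d)] + weight v = m" using that(2) by simp
    ultimately show "basis ((Suc j, d) # v) \<in> ?B"
      using that(1) bullet_words_raise_letter[of j d v, symmetric] by blast
  qed
  show ?case
  proof (cases k)
    case (Suc j)
    then show ?thesis using raised w by (simp add: x)
  next
    case 0
    have "cons_vec (basis x) p \<in> free.span ?B" if "p \<in> free.span ?B"
      for p :: "(nat \<times> 'd, 'k) tensor"
      using that
    proof (induction p rule: free.span_induct)
      show "free.subspace {p. cons_vec (basis x) p \<in> free.span ?B}"
        by (intro free.subspaceI)
          (simp_all add: bilin_simps free.span_zero free.span_add free.span_scale)
      fix p :: "(nat \<times> 'd, 'k) tensor" assume "p \<in> ?B"
      then obtain u v where uv: "u \<in> lists (biletters D)" "v \<in> lists (biletters D)"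
        "weight u + weight v = m" and p: "p = bullet_words raise u v" by blast
      have "x # u \<in> lists (biletters D)" "weight (x # u) + weight v = m"
        using d uv by (simp_all add: x 0 biletters_def)
      with uv(2) have "(bullet_words raise (x # u) v :: (nat \<times> 'd, 'k) tensor) \<in> free.span ?B"
        by (intro free.span_base) blast
      moreover have "cons_vec (basis (Suc 0, d)) (shuffle_words u v :: (nat \<times> 'd, 'k) tensor)
          \<in> free.span ?B"
      proof (rule cons_vec_basis_mem[OF free.subspace_span])
        fix s assume "s \<in> Poly_Mapping.keys (shuffle_words u v :: (nat \<times> 'd, 'k) tensor)"
        then have s: "s \<in> shuffles u v" by (simp add: keys_shuffle_words)
        with uv(1,2) have "s \<in> lists (biletters D)"
          by (auto dest: set_shuffles)
        with s uv(3) show "basis ((Suc 0, d) # s) \<in> free.span ?B"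
          by (intro raised) (simp_all add: weight_shuffles)
      qed
      ultimately have "bullet_words raise (x # u) v - cons_vec (basis (Suc 0, d)) (shuffle_words u v)
          \<in> free.span ?B" by (rule free.span_diff)
      then show "cons_vec (basis x) p \<in> free.span ?B"
        unfolding x 0 p bullet_words_raise_Cons by simp
    qed
    moreover have "basis w \<in> free.span ?B"
      using w 0 by (intro Cons.IH) (simp add: words_of_weight_def)
    ultimately have "cons_vec (basis x) (basis w) \<in> free.span ?B" by blast
    then show ?thesis by (simp add: product_basis)
  qed
qed

lemma tensor_space_subset_bullet_closed:
  fixes S :: "(nat \<times> 'd, 'k::field_char_0) tensor set"
  assumes S: "free.subspace S" and bullet: "\<And>p q. p \<in> S \<Longrightarrow> q \<in> S \<Longrightarrow> bullet raise p q \<in> S"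
    and words0: "\<And>w. w \<in> lists (biletters0 D) \<Longrightarrow> basis w \<in> S"
  shows "tensor_space (biletters D) \<subseteq> S"
  unfolding tensor_space_def
proof (rule supported_on_subset[OF S])
  fix w assume "w \<in> lists (biletters D)"
  then show "basis w \<in> S"
  proof (induction "weight w" arbitrary: w rule: less_induct)
    case less
    show ?case
    proof (cases "weight w")
      case 0
      with less.prems words0 show ?thesis
        by (simp add: words_of_weight_zero[symmetric] words_of_weight_def)
    next
      case (Suc m)
      let ?B = "{bullet_words raise u v | u v. u \<in> lists (biletters D) \<and> v \<in> lists (biletters D)
        \<and> weight u + weight v = m} :: (nat \<times> 'd, 'k) tensor set"
      have "?B \<subseteq> S"
      proof
        fix p assume "p \<in> ?B"
        then obtain u v where uv: "u \<in> lists (biletters D)" "v \<in> lists (biletters D)"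
          "weight u + weight v = m" and p: "p = bullet_words raise u v" by blast
        then have "basis u \<in> S" "basis v \<in> S" using less.hyps Suc by auto
        then show "p \<in> S" using bullet p by (metis product_basis(3))
      qed
      then have "free.span ?B \<subseteq> S" by (rule free.span_minimal[OF _ S])
      with less.prems Suc show ?thesis
        using positive_weight_in_span_bullets[of w D m, where 'k = 'k]
        by (auto simp: words_of_weight_def)
    qed
  qed
qed

lemma tensor_space_bullet_closed:
  assumes "p \<in> tensor_space (biletters D)" "q \<in> tensor_space (biletters D)"
  shows "(bullet raise p q :: (nat \<times> 'd, 'k::field_char_0) tensor) \<in> tensor_space (biletters D)"
  unfolding tensor_space_def
proof (rule bullet_mem[OF subspace_supported_on])
  fix u v assume "u \<in> Poly_Mapping.keys p" "v \<in> Poly_Mapping.keys q"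
  with assms have "u \<in> words_of_weight D (weight u)" "v \<in> words_of_weight D (weight v)"
    by (auto simp: tensor_space_def supported_on_def words_of_weight_def)
  from bullet_words_raise_supported[OF this, where 'k = 'k]
  show "(bullet_words raise u v :: (nat \<times> 'd, 'k) tensor) \<in> supported_on (lists (biletters D))"
    by (auto simp: supported_on_def words_of_weight_def)
qed

lemma tensor_space_shuffle_closed:
  assumes "p \<in> tensor_space X" "q \<in> tensor_space X"
  shows "(shuffle p q :: ('x, 'k::field_char_0) tensor) \<in> tensor_space X"
  unfolding tensor_space_def
proof (rule shuffle_mem[OF subspace_supported_on])
  fix u v assume "u \<in> Poly_Mapping.keys p" "v \<in> Poly_Mapping.keys q"
  with assms have "u \<in> lists X" "v \<in> lists X" by (auto simp: tensor_space_def supported_on_def)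
  then show "(shuffle_words u v :: ('x, 'k) tensor) \<in> supported_on (lists X)"
    by (auto simp: supported_on_def keys_shuffle_words dest!: set_shuffles)
qed

lemma subspace_lookup_zero:
  "free.subspace {p. Poly_Mapping.lookup p b = (0 :: 'k::field)}"
  by (rule free.subspaceI) (auto simp: lookup_add)

theorem pre_lie_generated_words0:
  "pre_lie_generated raise (words0 D) =
     (tensor_space (biletters D) :: (nat \<times> 'd, 'k::field_char_0) tensor set)"
  unfolding pre_lie_generated_def
proof (rule hull_unique)
  show "words0 D \<subseteq> tensor_space (biletters D)"
    by (auto simp: words0_def tensor_space_def basis_in_supported_on biletters0_def biletters_def)
  show "free.subspace (tensor_space (biletters D) :: (nat \<times> 'd, 'k) tensor set) \<and>
      (\<forall>a\<in>tensor_space (biletters D). \<forall>b\<in>tensor_space (biletters D).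
        (bullet raise a b :: (nat \<times> 'd, 'k) tensor) \<in> tensor_space (biletters D))"
    using tensor_space_bullet_closed by (auto simp: tensor_space_def subspace_supported_on)
next
  fix S :: "(nat \<times> 'd, 'k) tensor set"
  assume W: "words0 D \<subseteq> S"
    and S: "free.subspace S \<and> (\<forall>a\<in>S. \<forall>b\<in>S. bullet raise a b \<in> S)"
  show "tensor_space (biletters D) \<subseteq> S"
    by (rule tensor_space_subset_bullet_closed) (use W S in \<open>auto simp: words0_def\<close>)
qed

text \<open>The tensors whose coefficient at the missing word is zero form a subalgebra, because products have
  no terms of weight zero.\<close>

theorem words0_minimal:
  fixes G :: "(nat \<times> 'd, 'k::field_char_0) tensor set"
  assumes "G \<subset> words0 D"
  shows "pre_lie_generated raise G \<noteq> tensor_space (biletters D)"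
proof -
  from assms obtain w where w: "w \<in> lists (biletters0 D)" "basis w \<notin> G"
    by (auto simp: words0_def)
  let ?S = "{p. Poly_Mapping.lookup p w = 0} :: (nat \<times> 'd, 'k) tensor set"
  have w0: "w \<in> words_of_weight D 0" using w(1) by (simp add: words_of_weight_zero)
  have "pre_lie_generated raise G \<subseteq> ?S"
    unfolding pre_lie_generated_def
  proof (rule hull_minimal)
    show "G \<subseteq> ?S"
      using assms w(2) by (auto simp: words0_def lookup_basis)
    show "free.subspace ?S \<and> (\<forall>a\<in>?S. \<forall>b\<in>?S. bullet raise a b \<in> ?S)"
      using w0 by (simp add: subspace_lookup_zero lookup_bullet_raise words_of_weight_def)
  qed
  moreover have "basis w \<notin> ?S" by (simp add: lookup_basis)
  moreover have "basis w \<in> tensor_space (biletters D)"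
    using w0 by (simp add: tensor_space_def basis_in_supported_on words_of_weight_def)
  ultimately show ?thesis by blast
qed

section \<open>Generation by Lyndon words\<close>

lemma lexord_biletters0_less:
  assumes "u \<in> lists (biletters0 D)" "v \<in> lists (biletters0 D)"
  shows "(u, v) \<in> lexord biletters0_less \<longleftrightarrow> u < v"
  using assms
proof (induction u v rule: list_induct2')
  case (4 x xs y ys)
  then obtain d e where xy: "x = (0, d)" "y = (0, e)" by (auto simp: biletters0_def)
  have "(x, y) \<in> biletters0_less \<longleftrightarrow> x < y" by (simp add: xy biletters0_less_def)
  with 4 show ?case by simp
qed simp_all

text \<open>On biletters of weight zero the given order is the lexicographic order of pairs, so the theory of
  Lyndon words over a linearly ordered alphabet applies.\<close>

lemma lyndon_biletters0:
  fixes w :: "(nat \<times> 'd::linorder) list"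
  assumes "w \<in> lists (biletters0 D)"
  shows "lyndon biletters0_less w \<longleftrightarrow> Lyndon w"
proof -
  have "(w, v) \<in> lexord biletters0_less \<longleftrightarrow> (w, v) \<in> lexord {(x, y). x < y}"
    if "w = u @ v" for u v
    using assms that lexord_biletters0_less[of w D v] by (simp add: list_less_def)
  then show ?thesis unfolding lyndon_def by metis
qed

text \<open>The spanning part of Radford's theorem produces all words of weight zero, and these generate
  everything under \<open>\<bullet>\<close> alone.\<close>

theorem com_pre_lie_generated_lyndon_words0:
  fixes D :: "'d::linorder set"
  shows "com_pre_lie_generated raise (insert (basis []) (lyndon_words0 D)) =
     (tensor_space (biletters D) :: (nat \<times> 'd, 'k::field_char_0) tensor set)"
  unfolding com_pre_lie_generated_def
proof (rule hull_unique)
  show "insert (basis []) (lyndon_words0 D) \<subseteq> tensor_space (biletters D)"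
    by (auto simp: lyndon_words0_def tensor_space_def basis_in_supported_on biletters0_def biletters_def)
  show "free.subspace (tensor_space (biletters D) :: (nat \<times> 'd, 'k) tensor set) \<and>
      (\<forall>a\<in>tensor_space (biletters D). \<forall>b\<in>tensor_space (biletters D).
        (shuffle a b :: (nat \<times> 'd, 'k) tensor) \<in> tensor_space (biletters D) \<and>
        bullet raise a b \<in> tensor_space (biletters D))"
    using tensor_space_bullet_closed tensor_space_shuffle_closed
    by (auto simp: tensor_space_def subspace_supported_on)
next
  fix S :: "(nat \<times> 'd, 'k) tensor set"
  assume L: "insert (basis []) (lyndon_words0 D) \<subseteq> S"
    and S: "free.subspace S \<and> (\<forall>a\<in>S. \<forall>b\<in>S. shuffle a b \<in> S \<and> bullet raise a b \<in> S)"
  from S have sub: "free.subspace S"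
    and shuffle: "\<And>p q. p \<in> S \<Longrightarrow> q \<in> S \<Longrightarrow> shuffle p q \<in> S"
    and bullet: "\<And>p q. p \<in> S \<Longrightarrow> q \<in> S \<Longrightarrow> bullet raise p q \<in> S"
    by simp_all
  have lyndon: "basis l \<in> S" if "l \<in> lists (biletters0 D)" "Lyndon l" for l
  proof -
    have "lyndon biletters0_less l" using that(2) by (simp only: lyndon_biletters0[OF that(1)])
    with that(1) L show ?thesis unfolding lyndon_words0_def by blast
  qed
  have words: "basis w \<in> S" if "w \<in> lists (biletters0 D)" for w
    using L by (intro basis_mem_shuffle_closed[OF sub _ shuffle lyndon that]) simp
  show "tensor_space (biletters D) \<subseteq> S"
    by (rule tensor_space_subset_bullet_closed[OF sub bullet words])
qed

theorem empty_word_not_generated: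
  assumes "G \<subseteq> lyndon_words0 D"
  shows "(basis [] :: (nat \<times> 'd::linorder, 'k::field_char_0) tensor) \<notin> com_pre_lie_generated raise G"
proof -
  let ?S = "{p. Poly_Mapping.lookup p [] = 0} :: (nat \<times> 'd, 'k) tensor set"
  have "com_pre_lie_generated raise G \<subseteq> ?S"
    unfolding com_pre_lie_generated_def
  proof (rule hull_minimal)
    show "G \<subseteq> ?S"
      using assms by (auto simp: lyndon_words0_def lookup_basis lyndon_def)
    have "shuffle a b \<in> ?S" if "a \<in> ?S" for a b
    proof (rule shuffle_mem[OF subspace_lookup_zero])
      fix u v assume "u \<in> Poly_Mapping.keys a"
      with that have "[] \<notin> Poly_Mapping.keys (shuffle_words u v :: (nat \<times> 'd, 'k) tensor)"
        by (auto simp: keys_shuffle_words in_keys_iff)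
      then show "(shuffle_words u v :: (nat \<times> 'd, 'k) tensor) \<in> ?S"
        by (simp add: in_keys_iff)
    qed
    then show "free.subspace ?S \<and> (\<forall>a\<in>?S. \<forall>b\<in>?S. shuffle a b \<in> ?S \<and> bullet raise a b \<in> ?S)"
      by (simp add: subspace_lookup_zero lookup_bullet_raise)
  qed
  then show ?thesis by (auto simp: lookup_basis)
qed

text \<open>The subalgebra is contained in the sum of the span \<open>M\<close> of the monomials in the other Lyndon words
  and the ideal \<open>I\<close> of positive weight: \<open>M\<close> is closed under the shuffle product and \<open>I\<close> contains all
  products \<open>a \<bullet> b\<close>. By the independence of the monomials, \<open>l\<close> is not in \<open>M + I\<close>.\<close>

theorem Lyndon_word_not_generated:
  fixes l :: "(nat \<times> 'd::linorder) list"
  assumes "l \<in> lists (biletters0 D)" "Lyndon l"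
    and "G \<subseteq> insert (basis []) (lyndon_words0 D)" "basis l \<notin> G"
  shows "(basis l :: (nat \<times> 'd, 'k::field_char_0) tensor) \<notin> com_pre_lie_generated raise G"
proof
  let ?F = "{ls. lyndon_factorization ls \<and> (\<forall>m\<in>set ls. m \<noteq> l \<and> weight m = 0)}"
  let ?M = "free.span (shuffle_monomial ` ?F) :: (nat \<times> 'd, 'k) tensor set"
  let ?I = "supported_on {w. weight w \<noteq> 0} :: (nat \<times> 'd, 'k) tensor set"
  let ?S = "{q + i | q i. q \<in> ?M \<and> i \<in> ?I}"
  have monomials: "shuffle (shuffle_monomial ls) (shuffle_monomial ms) \<in> ?M"
    if "ls \<in> ?F" "ms \<in> ?F" for ls ms
  proof -
    \<comment> \<open>The product of two nonincreasing monomials is the monomial of the merged sequence.\<close>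
    let ?ns = "rev (sort (ls @ ms))"
    have "?ns \<in> ?F"
      using that by (auto simp: lyndon_factorization_def sorted_wrt_rev)
    then have "shuffle_monomial ?ns \<in> ?M" by (intro free.span_base imageI)
    also have "shuffle_monomial ?ns = (shuffle_monomial (ls @ ms) :: (nat \<times> 'd, 'k) tensor)"
      by (rule shuffle_monomial_mset) simp
    finally show ?thesis by (simp add: shuffle_monomial_append)
  qed
  have right: "shuffle (shuffle_monomial ls) q \<in> ?M" if "q \<in> ?M" "ls \<in> ?F" for q ls
    using that(1)
  proof (induction q rule: free.span_induct)
    show "free.subspace {q. shuffle (shuffle_monomial ls) q \<in> ?M}"
      by (intro free.subspaceI)
        (simp_all add: bilin_simps free.span_zero free.span_add free.span_scale)
  qed (use monomials that(2) in blast)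
  have M: "shuffle p q \<in> ?M" if "p \<in> ?M" "q \<in> ?M" for p q
    using that(1)
  proof (induction p rule: free.span_induct)
    show "free.subspace {p. shuffle p q \<in> ?M}"
      by (intro free.subspaceI)
        (simp_all add: bilin_simps free.span_zero free.span_add free.span_scale)
  qed (use right that(2) in blast)
  have "com_pre_lie_generated raise G \<subseteq> ?S"
    unfolding com_pre_lie_generated_def
  proof (rule hull_minimal)
    show "G \<subseteq> ?S"
    proof
      fix g assume g: "g \<in> G"
      then consider "g = basis []"
        | m where "g = basis m" "m \<in> lists (biletters0 D)" "lyndon biletters0_less m"
        using assms(3) by (auto simp: lyndon_words0_def)
      then have "\<exists>ls\<in>?F. g = shuffle_monomial ls"
      proof cases
        case 1
        then show ?thesis
          by (intro bexI[of _ "[]"]) (simp_all add: lyndon_factorization_def)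
      next
        case 2
        then have "m \<in> words_of_weight D 0" "Lyndon m" "m \<noteq> l"
          using g assms(4) by (auto simp: words_of_weight_zero lyndon_biletters0)
        with 2(1) show ?thesis
          by (intro bexI[of _ "[m]"])
            (simp_all add: lyndon_factorization_def words_of_weight_def shuffle_Nil)
      qed
      then have "g \<in> ?M" by (auto intro: free.span_base)
      moreover have "0 \<in> ?I" by (rule free.subspace_0[OF subspace_supported_on])
      ultimately show "g \<in> ?S" by force
    qed
    have "shuffle a b \<in> ?S" if "a \<in> ?S" "b \<in> ?S" for a b
    proof -
      from that obtain q i q' i' where qi: "q \<in> ?M" "i \<in> ?I" "q' \<in> ?M" "i' \<in> ?I"
        and ab: "a = q + i" "b = q' + i'" by blast
      have "shuffle i b \<in> ?I" using qi(2) by (rule shuffle_positive_weight)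
      moreover have "shuffle q i' \<in> ?I"
        using shuffle_positive_weight[OF qi(4), of q] by (simp add: shuffle_commute)
      ultimately have "shuffle q i' + shuffle i b \<in> ?I"
        by (intro free.subspace_add[OF subspace_supported_on])
      moreover have "shuffle a b = shuffle q q' + (shuffle q i' + shuffle i b)"
        by (simp add: ab bilin_simps)
      ultimately show ?thesis using M[OF qi(1,3)] by blast
    qed
    moreover have "bullet raise a b \<in> ?S" for a b
    proof -
      have "bullet raise a b = 0 + bullet raise a b" by simp
      then show ?thesis using bullet_raise_positive_weight[of a b] free.span_zero by blast
    qed
    moreover have "free.subspace ?S"
      by (rule free.subspace_sums[OF free.subspace_span subspace_supported_on])
    ultimately show "free.subspace ?S \<and> (\<forall>a\<in>?S. \<forall>b\<in>?S. shuffle a b \<in> ?S \<and> bullet raise a b \<in> ?S)"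
      by (intro conjI ballI)
  qed
  moreover assume "(basis l :: (nat \<times> 'd, 'k) tensor) \<in> com_pre_lie_generated raise G"
  ultimately have "basis l \<in> ?S" by (rule subsetD)
  then obtain q i where qi: "q \<in> ?M" "i \<in> ?I" "basis l = q + i" by blast
  have "\<exists>ls\<in>insert [l] ?F. Poly_Mapping.lookup q (concat ls) \<noteq> Poly_Mapping.lookup (basis l) (concat ls)"
    by (rule Lyndon_word_not_in_span[OF assms(2) _ _ qi(1)]) auto
  then obtain ls where ls: "ls \<in> insert [l] ?F"
    and "Poly_Mapping.lookup q (concat ls) \<noteq> Poly_Mapping.lookup (basis l) (concat ls)" by blast
  then have i: "Poly_Mapping.lookup i (concat ls) \<noteq> 0"
    unfolding qi(3) by (simp add: lookup_add)
  have "weight l = 0" using assms(1) by (simp add: words_of_weight_zero[symmetric] words_of_weight_def)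
  with ls have "weight (concat ls) = 0" by (auto simp: weight_concat_eq_0_iff)
  with i qi(2) show False by (auto simp: supported_on_def in_keys_iff)
qed

theorem lyndon_words0_minimal:
  fixes G :: "(nat \<times> 'd::linorder, 'k::field_char_0) tensor set"
  assumes "G \<subset> insert (basis []) (lyndon_words0 D)"
  shows "com_pre_lie_generated raise G \<noteq> tensor_space (biletters D)"
proof (cases "basis [] \<in> G")
  case True
  obtain g where "g \<in> insert (basis []) (lyndon_words0 D)" "g \<notin> G"
    using assms by blast
  with True have "g \<in> lyndon_words0 D" "g \<notin> G" by auto
  then obtain l where l: "l \<in> lists (biletters0 D)" "lyndon biletters0_less l" "basis l \<notin> G"
    unfolding lyndon_words0_def by blast
  then have "Lyndon l" using lyndon_biletters0[OF l(1)] by blast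
  then have "basis l \<notin> com_pre_lie_generated raise G"
    using assms l by (intro Lyndon_word_not_generated) blast+
  moreover have "(basis l :: (nat \<times> 'd, 'k) tensor) \<in> tensor_space (biletters D)"
    using l(1) by (auto simp: tensor_space_def basis_in_supported_on biletters_def biletters0_def)
  ultimately show ?thesis by blast
next
  case False
  with assms have "basis [] \<notin> com_pre_lie_generated raise G"
    by (intro empty_word_not_generated) auto
  moreover have "(basis [] :: (nat \<times> 'd, 'k) tensor) \<in> tensor_space (biletters D)"
    by (simp add: tensor_space_def basis_in_supported_on)
  ultimately show ?thesis by blast
qed

theorem proposition22:
  fixes D :: "'d::linorder set"
    and T W L :: "(nat \<times> 'd, 'k::field_char_0) tensor set"
  assumes T: "T = tensor_space (biletters D)"
    and W: "W = words0 D"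
    and L: "L = insert (basis []) (lyndon_words0 D)"
  shows "(pre_lie_generated raise W = T \<and>
          (\<forall>G. G \<subset> W \<longrightarrow> pre_lie_generated raise G \<noteq> T)) \<and>
         (com_pre_lie_generated raise L = T \<and>
          (\<forall>G. G \<subset> L \<longrightarrow> com_pre_lie_generated raise G \<noteq> T))"
  unfolding T W L
  by (simp add: pre_lie_generated_words0 words0_minimal
    com_pre_lie_generated_lyndon_words0 lyndon_words0_minimal)

end
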